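(* Let $\omega>0$ and $q>p>1$ be real numbers, and for $u>0$ put $f(u)=-\omega u+u^p-u^q$ and $F(u)=\int_0^u f(s)\,ds$. Then the following two equivalences hold. (1) The condition $$F(u)>0 \quad\text{for some } u>0$$ is equivalent to the condition $$\tilde F(u):=(uf(u))'F(u)-u f(u)^2<0 \quad\text{for every } u>0.$$ (2) The condition $$\tilde f(u):=(uf'(u))'f(u)-u f'(u)^2<0 \quad\text{for every } u>0$$ is equivalent to the condition $$f(u)>0 \quad\text{for some } u>0.$$
   Context: Primes denote differentiation with respect to $u$; thus $(uf(u))'=\frac{d}{du}\bigl(u f(u)\bigr)$ and $(uf'(u))'=\frac{d}{du}\bigl(u f'(u)\bigr)$. The exponents $p,q$ are real. *)

theory Defs
  imports "HOL-Analysis.Analysis"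
begin

(* At u = 0 the convention 0 powr a = 0 gives the value 0, the continuous extension
   for positive exponents; only values at u \<ge> 0 are ever used. *)
definition nonlin :: "real \<Rightarrow> real \<Rightarrow> real \<Rightarrow> real \<Rightarrow> real" where
  "nonlin \<omega> p q u = - \<omega> * u + u powr p - u powr q"

definition primitive :: "(real \<Rightarrow> real) \<Rightarrow> real \<Rightarrow> real" where
  "primitive f u = integral {0..u} f"

definition tilde_F :: "(real \<Rightarrow> real) \<Rightarrow> real \<Rightarrow> real" where
  "tilde_F f u = deriv (\<lambda>v. v * f v) u * primitive f u - u * (f u)\<^sup>2"

definition tilde_f :: "(real \<Rightarrow> real) \<Rightarrow> real \<Rightarrow> real" where
  "tilde_f f u = deriv (\<lambda>v. v * deriv f v) u * f u - u * (deriv f u)\<^sup>2"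

end

theory Submission
  imports Defs
begin

text \<open>
  Let \<open>g u = - A u\<^sup>a + B u\<^sup>b - C u\<^sup>c\<close> with \<open>a < b < c\<close> and write \<open>\<theta> = u d/du\<close>. Then
  \<open>\<theta>\<^sup>2g \<cdot> g - (\<theta>g)\<^sup>2 = - A B (b-a)\<^sup>2 u\<^sup>a\<^sup>+\<^sup>b + A C (c-a)\<^sup>2 u\<^sup>a\<^sup>+\<^sup>c - B C (c-b)\<^sup>2 u\<^sup>b\<^sup>+\<^sup>c\<close>.
  After division by \<open>u\<^sup>b\<close> and \<open>u\<^sup>a\<^sup>+\<^sup>c\<close> respectively, \<open>g\<close> and this expression attain their
  maxima over \<open>u > 0\<close> at the same point \<open>u\<^sub>0\<close>, given by
  \<open>(c-b) C u\<^sub>0\<^sup>c = (b-a) A u\<^sub>0\<^sup>a\<close>, and the first maximum is positive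
  exactly when the second is negative. Both claims are instances:
  \<open>u \<cdot> tilde_F = \<theta>\<^sup>2F \<cdot> F - (\<theta>F)\<^sup>2\<close> and \<open>u \<cdot> tilde_f = \<theta>\<^sup>2f \<cdot> f - (\<theta>f)\<^sup>2\<close>.
\<close>

text \<open>The exponents are left free so that \<open>f\<close>, \<open>F\<close> and their images
  under \<theta> are all instances.\<close>

definition trinomial :: "real \<Rightarrow> real \<Rightarrow> real \<Rightarrow> real \<Rightarrow> real \<Rightarrow> real \<Rightarrow> real \<Rightarrow> real" where
  "trinomial A a B b C c u = - A * u powr a + B * u powr b - C * u powr c"

text \<open>In other words, \<theta> multiplies each coefficient by its exponent and so preserves
  the family.\<close>

lemma has_real_derivative_trinomial:
  assumes "u > 0"
  shows "(trinomial A a B b C c has_real_derivative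
           trinomial (A * a) a (B * b) b (C * c) c u / u) (at u)"
  unfolding trinomial_def [abs_def]
  using assms by (auto intro!: derivative_eq_intros simp: powr_diff field_simps)

text \<open>Apply exp t \<ge> 1 + t to both powers of \<open>x\<close>; the weights \<open>e\<close>
  and \<open>d\<close> make the terms in \<open>ln x\<close> cancel. Equality holds at
  \<open>x = 1\<close>.\<close>

lemma add_le_weighted_powr:
  fixes x d e :: real
  assumes "x > 0" "d > 0" "e > 0"
  shows "d + e \<le> e * x powr (- d) + d * x powr e"
proof -
  have "e * (1 + (- d) * ln x) \<le> e * x powr (- d)" "d * (1 + e * ln x) \<le> d * x powr e"
    using assms exp_ge_add_one_self [of "- d * ln x"] exp_ge_add_one_self [of "e * ln x"]
    by (simp_all add: powr_def)
  then show ?thesis by (simp add: algebra_simps)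
qed

text \<open>The squares of single terms cancel, and two terms with exponents r and s combine with
  the factor r^2 + s^2 - 2rs = (r - s)^2.\<close>

lemma trinomial_log_concavity_identity:
  "trinomial (A * a * a) a (B * b * b) b (C * c * c) c u * trinomial A a B b C c u
           - (trinomial (A * a) a (B * b) b (C * c) c u)\<^sup>2
         = - (A * u powr a) * (B * u powr b) * (b - a)\<^sup>2 + (A * u powr a) * (C * u powr c) * (c - a)\<^sup>2
           - (B * u powr b) * (C * u powr c) * (c - b)\<^sup>2"
  unfolding trinomial_def by (simp add: power2_eq_square algebra_simps)

theorem trinomial_positive_iff:
  assumes "A > 0" "B > 0" "C > 0" "a < b" "b < c"
  shows "(\<exists>u>0. trinomial A a B b C c u > 0) \<longleftrightarrow>
         (\<forall>u>0. trinomial (A * a * a) a (B * b * b) b (C * c * c) c u * trinomial A a B b C c u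
                  - (trinomial (A * a) a (B * b) b (C * c) c u)\<^sup>2 < 0)"
    (is "?P \<longleftrightarrow> (\<forall>u>0. ?T u < 0)")
proof -
  define d e where "d = b - a" and "e = c - b"
  have de: "d > 0" "e > 0" "c - a = d + e" using assms by (auto simp: d_def e_def)
  \<comment> \<open>\<open>u0\<close> is the critical point of \<open>g\<close> divided by the power
    with exponent \<open>b\<close>. The scale \<open>k\<close> makes the outer terms at
    \<open>u0\<close> equal to \<open>e * k\<close> and \<open>d * k\<close>.\<close>
  define u0 where "u0 = (d * A / (e * C)) powr (1 / (d + e))"
  define k where "k = A * u0 powr a / e"
  define Y where "Y = B * u0 powr b"
  have u0: "u0 > 0" using assms de by (simp add: u0_def)
  have k: "k > 0" and Y: "Y > 0" using assms de u0 by (simp_all add: k_def Y_def)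
  have A0: "A * u0 powr a = e * k" using de by (simp add: k_def)
  have "u0 powr c = u0 powr a * u0 powr (d + e)"
    by (simp add: d_def e_def flip: powr_add)
  also have "u0 powr (d + e) = d * A / (e * C)"
    using assms de by (simp add: u0_def powr_powr)
  finally have C0: "C * u0 powr c = d * k"
    using assms de by (simp add: k_def field_simps)
  have scaled: "A * (u0 * x) powr a = e * k * x powr a" "B * (u0 * x) powr b = Y * x powr b"
      "C * (u0 * x) powr c = d * k * x powr c" if "x > 0" for x
    using that u0 A0 C0 by (simp_all add: powr_mult Y_def flip: mult.assoc)
  have g: "trinomial A a B b C c (u0 * x)
             = x powr b * (Y - k * (e * x powr (- d) + d * x powr e))" if "x > 0" for x
  proof -
    have "x powr a = x powr b * x powr (- d)" "x powr c = x powr b * x powr e"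
      by (simp_all add: d_def e_def flip: powr_add)
    then show ?thesis
      unfolding trinomial_def using scaled [OF that] by (simp add: algebra_simps)
  qed
  \<comment> \<open>The bracket has the same shape as in \<open>g\<close>, with \<open>d\<close> and
    \<open>e\<close> exchanged in the weighted sum, so \<open>x = 1\<close> is extremal
    again.\<close>
  have T: "?T (u0 * x)
      = d * e * k * x powr (a + c) * (k * (d + e)\<^sup>2 - Y * (d * x powr (- e) + e * x powr d))"
    if "x > 0" for x
  proof -
    have eqs: "x powr b * x powr a = x powr (a + c) * x powr (- e)"
      "x powr b * x powr c = x powr (a + c) * x powr d"
      "x powr a * x powr c = x powr (a + c)"
      by (simp_all add: d_def e_def add.commute flip: powr_add)
    have "?T (u0 * x) = - d * e * k * Y * d * (x powr b * x powr a)
        + d * e * k * k * (d + e)\<^sup>2 * (x powr a * x powr c)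
        - d * e * k * Y * e * (x powr b * x powr c)"
      using trinomial_log_concavity_identity [of A a B b C c "u0 * x"] u0 that scaled [OF that] de
      by (simp add: power2_eq_square algebra_simps flip: d_def e_def)
    then show ?thesis unfolding eqs by (simp add: algebra_simps)
  qed
  have range: "(\<forall>u>0. Q u) \<longleftrightarrow> (\<forall>x>0. Q (u0 * x))" for Q :: "real \<Rightarrow> bool"
  proof safe
    fix u :: real assume "\<forall>x>0. Q (u0 * x)" "u > 0"
    then have "Q (u0 * (u / u0))" using u0 by (metis divide_pos_pos)
    then show "Q u" using u0 by simp
  qed (use u0 in simp)
  \<comment> \<open>Both sides of the theorem reduce to this one inequality, the sign condition at
    \<open>x = 1\<close>.\<close>
  have "?P \<longleftrightarrow> Y > k * (d + e)"
  proof
    assume ?P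
    then obtain x where x: "x > 0" "trinomial A a B b C c (u0 * x) > 0"
      using range [of "\<lambda>u. \<not> trinomial A a B b C c u > 0"] by blast
    then have "Y > k * (e * x powr (- d) + d * x powr e)"
      by (simp add: g zero_less_mult_iff)
    then show "Y > k * (d + e)"
      using mult_left_mono [OF add_le_weighted_powr [of x d e], of k] x de k by linarith
  next
    assume "Y > k * (d + e)"
    then have "trinomial A a B b C c u0 > 0" using g [of 1] by (simp add: add.commute)
    then show ?P using u0 by blast
  qed
  also have "\<dots> \<longleftrightarrow> (\<forall>u>0. ?T u < 0)"
  proof
    assume Yk: "Y > k * (d + e)"
    show "\<forall>u>0. ?T u < 0"
      unfolding range [of "\<lambda>u. ?T u < 0"]
    proof safe
      fix x :: real assume x: "x > 0"
      have "k * (d + e)\<^sup>2 < Y * (d + e)"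
        using Yk de by (simp add: power2_eq_square flip: mult.assoc)
      also have "\<dots> \<le> Y * (d * x powr (- e) + e * x powr d)"
        using add_le_weighted_powr [of x e d] x de Y by (simp add: add.commute)
      finally show "?T (u0 * x) < 0"
        unfolding T [OF x] using x de k by (intro mult_pos_neg) auto
    qed
  next
    assume "\<forall>u>0. ?T u < 0"
    then have "?T (u0 * 1) < 0" using u0 by simp
    then have "d * e * k * ((d + e) * (k * (d + e) - Y)) < 0"
      unfolding T [OF zero_less_one] by (simp add: power2_eq_square algebra_simps)
    then show "Y > k * (d + e)" using de k by (simp add: mult_less_0_iff)
  qed
  finally show ?thesis .
qed

lemma nonlin_eq_trinomial:
  "u > 0 \<Longrightarrow> nonlin \<omega> p q u = trinomial \<omega> 1 1 p 1 q u"
  by (simp add: nonlin_def trinomial_def)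

lemma primitive_nonlin:
  assumes "p > 0" "q > 0" "u > 0"
  shows "primitive (nonlin \<omega> p q) u
           = trinomial (\<omega> / 2) 2 (1 / (p + 1)) (p + 1) (1 / (q + 1)) (q + 1) u"
    (is "_ = ?G u")
proof -
  have "(nonlin \<omega> p q has_integral ?G u - ?G 0) {0..u}"
  \<comment> \<open>The derivative formula is available only for \<open>x > 0\<close>, so the
    endpoint 0 is covered by continuity; \<open>?G 0 = 0\<close> because
    \<open>0 powr r = 0\<close>.\<close>
  proof (rule fundamental_theorem_of_calculus_interior)
    show "continuous_on {0..u} ?G"
      unfolding trinomial_def using assms
      by (intro continuous_on_add continuous_on_diff continuous_on_mult continuous_on_powr'
          continuous_on_const continuous_on_id) auto
    fix x assume "x \<in> {0<..<u}"
    then have "x > 0" by simp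
    then have "trinomial (\<omega> / 2 * 2) 2 (1 / (p + 1) * (p + 1)) (p + 1)
        (1 / (q + 1) * (q + 1)) (q + 1) x / x = nonlin \<omega> p q x"
      using assms
      by (simp add: trinomial_def nonlin_def powr_add field_simps power2_eq_square)
    with has_real_derivative_trinomial [OF \<open>x > 0\<close>]
    show "(?G has_vector_derivative nonlin \<omega> p q x) (at x)"
      by (metis has_real_derivative_iff_has_vector_derivative)
  qed (use assms in simp)
  then show ?thesis
    by (simp add: primitive_def integral_unique trinomial_def)
qed

lemma deriv_eq_on_positive:
  fixes f g :: "real \<Rightarrow> real"
  assumes "u > 0" "\<And>v. v > 0 \<Longrightarrow> f v = g v" "(g has_real_derivative D) (at u)"
  shows "deriv f u = D"
proof (rule DERIV_imp_deriv)
  show "(f has_real_derivative D) (at u)"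
    using assms by (intro has_field_derivative_transform_within_open [OF assms(3), of "{0<..}"]) auto
qed

text \<open>Since u f = \<theta>F, the derivative of u f is \<theta>(\<theta>F) / u, and u f^2 =
  (\<theta>F)^2 / u.\<close>

lemma tilde_F_nonlin:
  fixes \<omega> p q u :: real
  assumes "p > 0" "q > 0" "u > 0"
  defines "A \<equiv> \<omega> / 2" and "B \<equiv> 1 / (p + 1)" and "C \<equiv> 1 / (q + 1)"
  shows "tilde_F (nonlin \<omega> p q) u =
    (trinomial (A * 2 * 2) 2 (B * (p + 1) * (p + 1)) (p + 1) (C * (q + 1) * (q + 1)) (q + 1) u
       * trinomial A 2 B (p + 1) C (q + 1) u
     - (trinomial (A * 2) 2 (B * (p + 1)) (p + 1) (C * (q + 1)) (q + 1) u)\<^sup>2) / u"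
proof -
  let ?G1 = "trinomial (A * 2) 2 (B * (p + 1)) (p + 1) (C * (q + 1)) (q + 1)"
  have G1: "v * nonlin \<omega> p q v = ?G1 v" if "v > 0" for v
    using that assms(1,2)
    by (simp add: A_def B_def C_def nonlin_def trinomial_def powr_add algebra_simps power2_eq_square)
  have "deriv (\<lambda>v. v * nonlin \<omega> p q v) u =
      trinomial (A * 2 * 2) 2 (B * (p + 1) * (p + 1)) (p + 1) (C * (q + 1) * (q + 1)) (q + 1) u / u"
    using assms(3) by (intro deriv_eq_on_positive [OF _ G1 has_real_derivative_trinomial]) auto
  moreover have "u * (nonlin \<omega> p q u)\<^sup>2 = (?G1 u)\<^sup>2 / u"
    using assms(3) by (simp add: power2_eq_square flip: G1)
  ultimately show ?thesis
    using assms(1-3)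
    by (simp add: tilde_F_def primitive_nonlin A_def B_def C_def diff_divide_distrib)
qed

text \<open>The factors 1 stay unsimplified so that the right-hand side matches the instance of
  \<open>trinomial_positive_iff\<close> literally.\<close>

lemma tilde_f_nonlin:
  assumes "u > 0"
  shows "tilde_f (nonlin \<omega> p q) u =
    (trinomial (\<omega> * 1 * 1) 1 (1 * p * p) p (1 * q * q) q u * trinomial \<omega> 1 1 p 1 q u
     - (trinomial (\<omega> * 1) 1 (1 * p) p (1 * q) q u)\<^sup>2) / u"
proof -
  let ?g1 = "trinomial (\<omega> * 1) 1 (1 * p) p (1 * q) q"
  have f': "deriv (nonlin \<omega> p q) v = ?g1 v / v" if "v > 0" for v
    using that by (intro deriv_eq_on_positive [OF _ nonlin_eq_trinomial has_real_derivative_trinomial]) auto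
  have g1: "v * deriv (nonlin \<omega> p q) v = ?g1 v" if "v > 0" for v
    using that by (simp only: f') simp
  have "deriv (\<lambda>v. v * deriv (nonlin \<omega> p q) v) u =
      trinomial (\<omega> * 1 * 1) 1 (1 * p * p) p (1 * q * q) q u / u"
    using assms by (intro deriv_eq_on_positive [OF _ g1 has_real_derivative_trinomial]) auto
  moreover have "u * (deriv (nonlin \<omega> p q) u)\<^sup>2 = (?g1 u)\<^sup>2 / u"
    using assms by (simp add: f' power2_eq_square)
  ultimately show ?thesis
    using assms by (simp add: tilde_f_def nonlin_eq_trinomial diff_divide_distrib)
qed

theorem theorem1:
  fixes \<omega> p q :: real
  assumes "\<omega> > 0" and "p > 1" and "q > p"
  shows "((\<exists>u>0. primitive (nonlin \<omega> p q) u > 0) \<longleftrightarrow>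
            (\<forall>u>0. tilde_F (nonlin \<omega> p q) u < 0)) \<and>
         ((\<forall>u>0. tilde_f (nonlin \<omega> p q) u < 0) \<longleftrightarrow>
            (\<exists>u>0. nonlin \<omega> p q u > 0))"
proof
  have div: "x / u < 0 \<longleftrightarrow> x < 0" if "u > 0" for x u :: real
    using that by (simp add: divide_less_0_iff)
  have "(\<exists>u>0. primitive (nonlin \<omega> p q) u > 0) \<longleftrightarrow>
      (\<exists>u>0. trinomial (\<omega> / 2) 2 (1 / (p + 1)) (p + 1) (1 / (q + 1)) (q + 1) u > 0)"
    using assms by (intro ex_cong1 conj_cong refl) (simp add: primitive_nonlin)
  also have "\<dots> \<longleftrightarrow> (\<forall>u>0. tilde_F (nonlin \<omega> p q) u < 0)"
    by (subst trinomial_positive_iff)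
       (use assms in \<open>auto simp only: tilde_F_nonlin div intro!: divide_pos_pos\<close>)
  finally show "(\<exists>u>0. primitive (nonlin \<omega> p q) u > 0) \<longleftrightarrow>
            (\<forall>u>0. tilde_F (nonlin \<omega> p q) u < 0)" .
  have "(\<exists>u>0. nonlin \<omega> p q u > 0) \<longleftrightarrow> (\<exists>u>0. trinomial \<omega> 1 1 p 1 q u > 0)"
    by (intro ex_cong1 conj_cong refl) (simp add: nonlin_eq_trinomial)
  also have "\<dots> \<longleftrightarrow> (\<forall>u>0. tilde_f (nonlin \<omega> p q) u < 0)"
    by (subst trinomial_positive_iff)
       (use assms in \<open>auto simp only: tilde_f_nonlin div\<close>)
  finally show "(\<forall>u>0. tilde_f (nonlin \<omega> p q) u < 0) \<longleftrightarrow> (\<exists>u>0. nonlin \<omega> p q u > 0)" ..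
qed

end
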